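(* Fix reals $s,t>0$ and $0<\rho<1$. For each $n$ let $S,T\subseteq\{-1,1\}^n$ be the diametrically opposed Hamming balls $S=\{x:\sum_i x_i\le -s\,n^{1/2}\}$ and $T=\{x:\sum_i x_i\ge t\,n^{1/2}\}$. Let $x$ be chosen uniformly at random from $\{-1,1\}^n$ and let $y$ be a $\rho$-correlated copy of $x$. Then $$\lim_{n\to\infty}\Pr[x\in S,\ y\in T]\ \le\ \frac{\sqrt{1-\rho^2}}{2\pi s(\rho s+t)}\exp\left(-\frac12\,\frac{s^2+2\rho st+t^2}{1-\rho^2}\right).$$
   Context: Given $x\in\{-1,1\}^n$, a $\rho$-correlated copy $y$ of $x$ is the random string in $\{-1,1\}^n$ obtained by flipping each coordinate of $x$ independently with probability $\tfrac12-\tfrac12\rho$ (so that $\mathbf{E}[x_iy_i]=\rho$ independently for each $i$). The paper's standing range for the correlation parameter is $0<\rho<1$. *)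

theory Defs
  imports "HOL-Probability.Probability"
begin

text \<open>
  Points of the cube are functions \<open>nat \<Rightarrow> real\<close> that are \<open>undefined\<close> outside \<open>{..<n}\<close>,
  which makes the cube a finite set of size \<open>2 ^ n\<close>.
\<close>
definition cube :: "nat \<Rightarrow> (nat \<Rightarrow> real) set" where
  "cube n = {..<n} \<rightarrow>\<^sub>E {-1, 1}"

text \<open>The default value \<open>undefined\<close> of the product distribution agrees with that of \<open>cube\<close>.\<close>
definition correlated_copy :: "nat \<Rightarrow> real \<Rightarrow> (nat \<Rightarrow> real) \<Rightarrow> (nat \<Rightarrow> real) pmf" where
  "correlated_copy n \<rho> x =
     Pi_pmf {..<n} undefined
       (\<lambda>i. map_pmf (\<lambda>flip. if flip then - x i else x i) (bernoulli_pmf (1/2 - \<rho>/2)))"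

definition correlated_pair :: "nat \<Rightarrow> real \<Rightarrow> ((nat \<Rightarrow> real) \<times> (nat \<Rightarrow> real)) pmf" where
  "correlated_pair n \<rho> =
     bind_pmf (pmf_of_set (cube n)) (\<lambda>x. map_pmf (\<lambda>y. (x, y)) (correlated_copy n \<rho> x))"

definition lower_ball :: "nat \<Rightarrow> real \<Rightarrow> (nat \<Rightarrow> real) set" where
  "lower_ball n s = {x \<in> cube n. (\<Sum>i<n. x i) \<le> - s * sqrt (real n)}"

definition upper_ball :: "nat \<Rightarrow> real \<Rightarrow> (nat \<Rightarrow> real) set" where
  "upper_ball n t = {x \<in> cube n. (\<Sum>i<n. x i) \<ge> t * sqrt (real n)}"

end

theory Submission
  imports Defs "HOL-Real_Asymp.Real_Asymp"
begin

text \<open>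
  The pair of normalised sums $(\sum_i x_i, \sum_i y_i)/\sqrt n$ converges in law to a pair of
  standard normal variables with correlation \<open>\<rho>\<close>, so the probability converges to the mass
  that this bivariate normal law gives to the quadrant $(-\infty,-s]\times[t,\infty)$. The claim
  is an upper bound on that mass.

  Instead of a central limit theorem in the plane, the proof conditions on \<open>x\<close>. Given \<open>x\<close>, the
  sum of \<open>y\<close> is a sum of \<open>n\<close> independent signs with means \<open>\<rho> x\<^sub>i\<close>. Its characteristic function
  is explicit (\<open>char_copy_law\<close>) and depends on \<open>x\<close> only through the sum of \<open>x\<close>
  (\<open>copy_law_cong_sum\<close>). If the normalised sums of a sequence of points \<open>x\<close> tend to \<open>a\<close>, then
  Levy continuity gives the normal limit with mean \<open>\<rho> a\<close> and variance \<open>1 - \<rho>\<^sup>2\<close>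
  (\<open>copy_law_central_limit\<close>). The same lemma with \<open>\<rho> = 0\<close>, where the copy is a uniform point of
  the cube, is the central limit theorem for \<open>x\<close> itself. Skorohod's theorem makes the normalised
  sums of \<open>x\<close> converge pointwise, and the conditional probabilities then converge along almost
  every path; dominated convergence yields the limit
  $E[1_{X\le -s}\, Q((t-\rho X)/\sqrt{1-\rho^2})]$, where \<open>X\<close> is standard normal and \<open>Q\<close>
  (\<open>gaussian_tail\<close>) is its tail function (\<open>prob_opposite_balls_tendsto\<close>).

  For the bound, the Mills inequality \<open>Q(a) \<le> \<phi>(a)/a\<close> is used twice
  (\<open>gaussian_quadrant_le\<close>). Applied to the conditional tail it leaves the integral of
  $\phi(r)\,\phi((t-\rho r)/\sigma)$ over $r\le -s$, with $\sigma=\sqrt{1-\rho^2}$. The joint density is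
  symmetric in its two arguments, so this integrand is $\phi(t)\,\phi((r-\rho t)/\sigma)$, and
  integrating it gives a normal tail at $(s+\rho t)/\sigma$, to which the inequality applies again.
\<close>

section \<open>Sums of a correlated copy\<close>

definition scaled_sum :: "nat \<Rightarrow> (nat \<Rightarrow> real) \<Rightarrow> real" where
  "scaled_sum n x = (\<Sum>i<n. x i) / sqrt (real n)"

definition copy_law :: "nat \<Rightarrow> real \<Rightarrow> (nat \<Rightarrow> real) \<Rightarrow> real measure" where
  "copy_law n \<rho> x = distr (correlated_copy n \<rho> x) borel (scaled_sum n)"

lemma real_distribution_copy_law: "real_distribution (copy_law n \<rho> x)"
  unfolding copy_law_def
  by (rule prob_space.real_distribution_distr) (auto simp: measure_pmf.prob_space_axioms)

lemma cube_values: "x \<in> cube n \<Longrightarrow> i < n \<Longrightarrow> x i = -1 \<or> x i = 1"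
  by (auto simp: cube_def PiE_iff)

lemma char_copy_law:
  assumes "0 \<le> \<rho>" "\<rho> \<le> 1" "x \<in> cube n"
  shows "char (copy_law n \<rho> x) \<theta> =
    (\<Prod>i<n. Complex (cos (\<theta> / sqrt n)) (\<rho> * x i * sin (\<theta> / sqrt n)))"
proof -
  let ?M = "correlated_copy n \<rho> x"
  let ?u = "\<theta> / sqrt n"
  have ind: "prob_space.indep_vars ?M (\<lambda>_. borel) (\<lambda>i y. y i / sqrt n) {..<n}"
    unfolding correlated_copy_def
    by (rule prob_space.indep_vars_compose2[OF measure_pmf.prob_space_axioms indep_vars_Pi_pmf]) auto
  have coord: "char (distr ?M borel (\<lambda>y. y i / sqrt n)) \<theta> = Complex (cos ?u) (\<rho> * x i * sin ?u)"
    if "i < n" for i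
  proof -
    let ?p = "map_pmf (\<lambda>flip. if flip then - x i else x i) (bernoulli_pmf (1/2 - \<rho>/2))"
    have "char (distr ?M borel (\<lambda>y. y i / sqrt n)) \<theta> = (\<integral>y. iexp (\<theta> * (y i / sqrt n)) \<partial>?M)"
      by (simp add: char_def integral_distr)
    also have "\<dots> = (\<integral>v. iexp (\<theta> * (v / sqrt n)) \<partial>map_pmf (\<lambda>f. f i) ?M)"
      by simp
    also have "map_pmf (\<lambda>f. f i) ?M = ?p"
      using that by (simp add: correlated_copy_def Pi_pmf_component)
    also have "(\<integral>v. iexp (\<theta> * (v / sqrt n)) \<partial>?p)
      = iexp (\<theta> * (- x i / sqrt n)) * (1/2 - \<rho>/2) + iexp (\<theta> * (x i / sqrt n)) * (1 - (1/2 - \<rho>/2))"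
      using assms by (simp add: integral_measure_pmf[of UNIV] UNIV_bool scaleR_conv_of_real mult.commute)
    also have "\<dots> = Complex (cos ?u) (\<rho> * x i * sin ?u)"
      using cube_values[OF assms(3) that]
      by (auto simp: complex_eq_iff Re_exp Im_exp field_simps)
    finally show ?thesis .
  qed
  have "scaled_sum n = (\<lambda>y. \<Sum>i<n. y i / sqrt n)"
    by (auto simp: scaled_sum_def sum_divide_distrib)
  then have "char (copy_law n \<rho> x) \<theta> = (\<Prod>i<n. char (distr ?M borel (\<lambda>y. y i / sqrt n)) \<theta>)"
    unfolding copy_law_def
    using prob_space.char_distr_sum[OF measure_pmf.prob_space_axioms ind] by simp
  then show ?thesis using coord by simp
qed

text \<open>
  On the two points \<open>v = 1\<close> and \<open>v = -1\<close> any nonvanishing function has the form \<open>exp (a + b v)\<close>.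
  The factors of the characteristic function are such a function of the coordinates of \<open>x\<close>, so
  their product is a function of the sum of \<open>x\<close>. Positivity of \<open>\<rho>\<close> keeps the factors from
  vanishing where the cosine does.
\<close>
lemma copy_law_cong_sum:
  assumes "0 < \<rho>" "\<rho> \<le> 1" "x \<in> cube n" "x' \<in> cube n" "scaled_sum n x = scaled_sum n x'"
  shows "copy_law n \<rho> x = copy_law n \<rho> x'"
proof (rule Levy_uniqueness)
  show "char (copy_law n \<rho> x) = char (copy_law n \<rho> x')"
  proof
    fix \<theta>
    define z where "z v = Complex (cos (\<theta> / sqrt n)) (\<rho> * v * sin (\<theta> / sqrt n))" for v
    have nz: "z 1 \<noteq> 0" "z (-1) \<noteq> 0"
      using assms(1) sin_zero_norm_cos_one[of "\<theta> / sqrt n"] by (auto simp: z_def complex_eq_iff)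
    define a where "a = (Ln (z 1) + Ln (z (-1))) / 2"
    define b where "b = (Ln (z 1) - Ln (z (-1))) / 2"
    have z: "z v = exp (a + b * of_real v)" if "v = -1 \<or> v = 1" for v
    proof -
      have "a + b * of_real v = Ln (z v)"
        using that by (auto simp: a_def b_def field_simps)
      then show ?thesis using that nz by auto
    qed
    have p: "char (copy_law n \<rho> y) \<theta> = exp (of_nat n * a + b * of_real (\<Sum>i<n. y i))"
      if "y \<in> cube n" for y
    proof -
      have "char (copy_law n \<rho> y) \<theta> = (\<Prod>i<n. z (y i))"
        using assms that by (simp add: char_copy_law z_def)
      also have "\<dots> = (\<Prod>i<n. exp (a + b * of_real (y i)))"
        using cube_values[OF that] by (intro prod.cong refl z) auto
      also have "\<dots> = exp (\<Sum>i<n. a + b * of_real (y i))"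
        by (simp add: exp_sum)
      finally show ?thesis
        by (simp add: sum.distrib sum_distrib_left)
    qed
    have "(\<Sum>i<n. x i) = (\<Sum>i<n. x' i)"
      using assms(5) by (cases "n = 0") (auto simp: scaled_sum_def)
    then show "char (copy_law n \<rho> x) \<theta> = char (copy_law n \<rho> x') \<theta>"
      using p[OF assms(3)] p[OF assms(4)] by simp
  qed
qed (rule real_distribution_copy_law)+

section \<open>Central limit theorem conditional on the original point\<close>

text \<open>
  For \<open>\<bar>r\<bar> \<le> 1\<close> the first term is the characteristic function of a sign with mean \<open>r\<close>, the
  second that of a normal variable with the same mean and variance. The two agree to second order at \<open>0\<close>.
\<close>
lemma sign_char_approx_normal:
  fixes r u :: real
  shows "(\<lambda>n. real n * norm (Complex (cos (u / sqrt n)) (r * sin (u / sqrt n))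
     - exp (Complex (- (1 - r\<^sup>2) * (u / sqrt n)\<^sup>2 / 2) (r * (u / sqrt n))))) \<longlonglongrightarrow> 0"
proof (cases "u = 0")
  case True
  then show ?thesis by (simp add: complex_eq_iff zero_complex.code one_complex.code exp_zero
        flip: zero_complex.code one_complex.code)
next
  case False
  define d where "d v = Complex (cos v) (r * sin v) - exp (Complex (- (1 - r\<^sup>2) * v\<^sup>2 / 2) (r * v))" for v
  have "((\<lambda>v::real. (cos v - exp (- (1 - r\<^sup>2) * v\<^sup>2 / 2) * cos (r * v)) / v\<^sup>2) \<longlongrightarrow> 0) (at 0)"
    by real_asymp (simp_all add: power2_eq_square field_simps)
  moreover have "((\<lambda>v::real. (r * sin v - exp (- (1 - r\<^sup>2) * v\<^sup>2 / 2) * sin (r * v)) / v\<^sup>2) \<longlongrightarrow> 0) (at 0)"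
    by real_asymp
  ultimately have "((\<lambda>v. d v / of_real (v\<^sup>2)) \<longlongrightarrow> 0) (at 0)"
    by (simp add: tendsto_complex_iff d_def Re_exp Im_exp Re_divide_of_real Im_divide_of_real del: of_real_power)
  then have d0: "((\<lambda>v. norm (d v / of_real (v\<^sup>2))) \<longlongrightarrow> 0) (at 0)"
    by (rule tendsto_norm_zero)
  have "(\<lambda>n. u / sqrt (real n)) \<longlonglongrightarrow> 0"
    by real_asymp
  moreover have "\<forall>\<^sub>F n in sequentially. u / sqrt (real n) \<noteq> 0"
    using eventually_gt_at_top[of 0] by eventually_elim (use False in simp)
  ultimately have "filterlim (\<lambda>n. u / sqrt (real n)) (at 0) sequentially"
    by (simp add: filterlim_at)
  from tendsto_mult_right_zero[OF filterlim_compose[OF d0 this], of "u\<^sup>2"]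
  have "(\<lambda>n. u\<^sup>2 * norm (d (u / sqrt n) / of_real ((u / sqrt n)\<^sup>2))) \<longlonglongrightarrow> 0" .
  moreover have "u\<^sup>2 * norm (d (u / sqrt n) / of_real ((u / sqrt n)\<^sup>2)) = real n * norm (d (u / sqrt n))" for n
    using False by (simp add: norm_divide norm_mult norm_power power_divide)
  ultimately show ?thesis unfolding d_def by simp
qed

text \<open>
  Each coordinate of the copy is compared with a normal variable of the same mean and variance.
  All factors have modulus at most \<open>1\<close>, so the product of the characteristic functions changes
  by at most the sum of the \<open>n\<close> coordinate errors, each of which is \<open>o(1/n)\<close> and takes one of two
  values. The product of the normal factors is exactly the characteristic function of a normal
  variable with mean \<open>\<rho>\<close> times the normalised sum of \<open>x\<close>. The hypothesis constrains only this
  mean, so that at \<open>\<rho> = 0\<close> the points may be arbitrary.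
\<close>
lemma copy_law_central_limit:
  assumes "0 \<le> \<rho>" "\<rho> \<le> 1" "\<And>n. x n \<in> cube n"
    and m: "(\<lambda>n. \<rho> * scaled_sum n (x n)) \<longlonglongrightarrow> m"
  shows "weak_conv_m (\<lambda>n. copy_law n \<rho> (x n))
    (distr std_normal_distribution borel (\<lambda>z. m + sqrt (1 - \<rho>\<^sup>2) * z))"
proof (rule levy_continuity)
  interpret std: real_distribution std_normal_distribution by (rule real_dist_normal_dist)
  show "real_distribution (distr std_normal_distribution borel (\<lambda>z. m + sqrt (1 - \<rho>\<^sup>2) * z))"
    by simp
  fix \<theta>
  let ?\<sigma> = "sqrt (1 - \<rho>\<^sup>2)"
  have \<sigma>: "?\<sigma>\<^sup>2 = 1 - \<rho>\<^sup>2" using assms by (simp add: power_le_one)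
  have "char (distr std_normal_distribution borel (\<lambda>z. m + ?\<sigma> * z)) \<theta>
    = (\<integral>z. iexp (\<theta> * m) * iexp ((\<theta> * ?\<sigma>) * z) \<partial>std_normal_distribution)"
    by (simp add: char_def integral_distr algebra_simps exp_add)
  also have "\<dots> = iexp (\<theta> * m) * char std_normal_distribution (\<theta> * ?\<sigma>)"
    by (simp add: char_def)
  also have "\<dots> = exp (Complex (-(1-\<rho>\<^sup>2)*\<theta>\<^sup>2/2) (m * \<theta>))"
  proof -
    have "- (\<theta> * ?\<sigma>)\<^sup>2 / 2 = - (1 - \<rho>\<^sup>2) * \<theta>\<^sup>2 / 2"
      unfolding power_mult_distrib \<sigma> by (simp only: mult_minus_left mult.commute)
    then show ?thesis
      unfolding char_std_normal_distribution by (simp only:) (simp add: complex_eq_iff Re_exp Im_exp mult.commute)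
  qed
  finally have lim: "char (distr std_normal_distribution borel (\<lambda>z. m + ?\<sigma> * z)) \<theta>
    = exp (Complex (-(1-\<rho>\<^sup>2)*\<theta>\<^sup>2/2) (m * \<theta>))" .
  define z where "z n r = Complex (cos (\<theta> / sqrt n)) (r * sin (\<theta> / sqrt n))" for n :: nat and r
  define w where "w n r = exp (Complex (-(1-r\<^sup>2)*(\<theta>/sqrt n)\<^sup>2/2) (r*(\<theta>/sqrt n)))" for n :: nat and r
  have sq: "r\<^sup>2 \<le> 1" if "\<bar>r\<bar> \<le> 1" for r :: real
    using that by (simp add: abs_square_le_1)
  have z1: "norm (z n r) \<le> 1" if "\<bar>r\<bar> \<le> 1" for n r
  proof -
    have "(cos (\<theta> / sqrt n))\<^sup>2 + r\<^sup>2 * (sin (\<theta> / sqrt n))\<^sup>2 \<le> (cos (\<theta> / sqrt n))\<^sup>2 + 1 * (sin (\<theta> / sqrt n))\<^sup>2"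
      using sq[OF that] by (intro add_left_mono mult_right_mono) auto
    then show ?thesis by (simp add: z_def complex_norm power_mult_distrib)
  qed
  have w1: "norm (w n r) \<le> 1" if "\<bar>r\<bar> \<le> 1" for n r
    using sq[OF that] by (simp add: w_def mult_nonpos_nonneg)
  have r: "\<bar>\<rho> * x n i\<bar> \<le> 1" if "i < n" for n i
    using cube_values[OF assms(3) that] assms by auto
  \<comment> \<open>The variance \<open>1 - (\<rho> x\<^sub>i)\<^sup>2\<close> is the same for all coordinates because \<open>x\<^sub>i\<^sup>2 = 1\<close>.\<close>
  have prodw: "(\<Prod>i<n. w n (\<rho> * x n i)) = exp (Complex (-(1-\<rho>\<^sup>2)*\<theta>\<^sup>2/2) (\<rho> * scaled_sum n (x n) * \<theta>))"
    if "n > 0" for n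
  proof -
    have "(\<Prod>i<n. w n (\<rho> * x n i)) = exp (\<Sum>i<n. Complex (-(1-\<rho>\<^sup>2)*(\<theta>/sqrt n)\<^sup>2/2) (\<rho> * x n i *(\<theta>/sqrt n)))"
      unfolding exp_sum[OF finite_lessThan] w_def
      using cube_values[OF assms(3), of _ n] by (intro prod.cong refl) fastforce
    also have "(\<Sum>i<n. Complex (-(1-\<rho>\<^sup>2)*(\<theta>/sqrt n)\<^sup>2/2) (\<rho> * x n i *(\<theta>/sqrt n)))
      = Complex (-(1-\<rho>\<^sup>2)*\<theta>\<^sup>2/2) (\<rho> * scaled_sum n (x n) * \<theta>)"
      using that by (simp add: complex_eq_iff scaled_sum_def sum_distrib_left sum_distrib_right
          sum_divide_distrib power_divide mult_ac)
    finally show ?thesis .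
  qed
  let ?e = "\<lambda>n r. real n * norm (z n r - w n r)"
  \<comment> \<open>Each mean is \<open>\<rho>\<close> or \<open>-\<rho>\<close>; adding both errors bounds either.\<close>
  have bound: "norm ((\<Prod>i<n. z n (\<rho> * x n i)) - (\<Prod>i<n. w n (\<rho> * x n i))) \<le> ?e n \<rho> + ?e n (- \<rho>)" for n
  proof -
    have "norm ((\<Prod>i<n. z n (\<rho> * x n i)) - (\<Prod>i<n. w n (\<rho> * x n i)))
       \<le> (\<Sum>i<n. norm (z n (\<rho> * x n i) - w n (\<rho> * x n i)))"
      by (intro norm_prod_diff z1 w1 r) auto
    also have "\<dots> \<le> (\<Sum>i<n. norm (z n \<rho> - w n \<rho>) + norm (z n (- \<rho>) - w n (- \<rho>)))"
      using cube_values[OF assms(3), of _ n] by (intro sum_mono) fastforce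
    finally show ?thesis by (simp add: algebra_simps)
  qed
  have "(\<lambda>n. ?e n \<rho> + ?e n (- \<rho>)) \<longlonglongrightarrow> 0 + 0"
    unfolding z_def w_def by (intro tendsto_add sign_char_approx_normal)
  then have "(\<lambda>n. (\<Prod>i<n. z n (\<rho> * x n i)) - (\<Prod>i<n. w n (\<rho> * x n i))) \<longlonglongrightarrow> 0"
    by (intro Lim_null_comparison[OF always_eventually[rule_format, OF bound]]) simp
  moreover have "(\<lambda>n. \<Prod>i<n. w n (\<rho> * x n i)) \<longlonglongrightarrow> exp (Complex (-(1-\<rho>\<^sup>2)*\<theta>\<^sup>2/2) (m * \<theta>))"
  proof (rule Lim_transform_eventually)
    show "(\<lambda>n. exp (Complex (-(1-\<rho>\<^sup>2)*\<theta>\<^sup>2/2) (\<rho> * scaled_sum n (x n) * \<theta>)))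
       \<longlonglongrightarrow> exp (Complex (-(1-\<rho>\<^sup>2)*\<theta>\<^sup>2/2) (m * \<theta>))"
      by (intro tendsto_intros m)
    show "\<forall>\<^sub>F n in sequentially. exp (Complex (-(1-\<rho>\<^sup>2)*\<theta>\<^sup>2/2) (\<rho> * scaled_sum n (x n) * \<theta>)) = (\<Prod>i<n. w n (\<rho> * x n i))"
      using eventually_gt_at_top[of 0] by eventually_elim (simp add: prodw)
  qed
  ultimately have "(\<lambda>n. \<Prod>i<n. z n (\<rho> * x n i)) \<longlonglongrightarrow> exp (Complex (-(1-\<rho>\<^sup>2)*\<theta>\<^sup>2/2) (m * \<theta>))"
    using tendsto_add by fastforce
  then show "(\<lambda>n. char (copy_law n \<rho> (x n)) \<theta>) \<longlonglongrightarrow> char (distr std_normal_distribution borel (\<lambda>z. m + ?\<sigma> * z)) \<theta>"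
    unfolding lim using assms by (simp add: char_copy_law z_def mult_ac)
qed (rule real_distribution_copy_law)

section \<open>The bivariate normal quadrant\<close>

definition gaussian_tail :: "real \<Rightarrow> real" where "gaussian_tail u = measure std_normal_distribution {u..}"

lemma gaussian_tail_measurable [measurable]: "gaussian_tail \<in> borel_measurable borel"
proof -
  interpret real_distribution std_normal_distribution by (rule real_dist_normal_dist)
  have "mono (\<lambda>u. gaussian_tail (- u))"
    unfolding gaussian_tail_def by (intro monoI finite_measure_mono) auto
  then have [measurable]: "(\<lambda>u. gaussian_tail (- u)) \<in> borel_measurable borel"
    by (rule borel_measurable_mono)
  have "(\<lambda>u. gaussian_tail (- (- u))) \<in> borel_measurable borel"
    by measurable
  then show ?thesis by simp
qed

lemma gaussian_tail_nonneg: "0 \<le> gaussian_tail u" by (simp add: gaussian_tail_def)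

lemma gaussian_tail_le_1: "gaussian_tail u \<le> 1"
proof -
  interpret real_distribution std_normal_distribution by (rule real_dist_normal_dist)
  show ?thesis by (simp add: gaussian_tail_def)
qed

lemma ennreal_gaussian_tail: "ennreal (gaussian_tail u) = (\<integral>\<^sup>+z. ennreal (std_normal_density z) * indicator {u..} z \<partial>lborel)"
proof -
  interpret real_distribution std_normal_distribution by (rule real_dist_normal_dist)
  have "ennreal (gaussian_tail u) = emeasure std_normal_distribution {u..}"
    by (simp add: gaussian_tail_def emeasure_eq_measure)
  then show ?thesis by (simp add: emeasure_density)
qed

text \<open>
  The Mills inequality: on \<open>z \<ge> a\<close> the density \<open>\<phi>(z)\<close> is at most \<open>(z/a) \<phi>(z)\<close>, which has the
  antiderivative \<open>- \<phi>(z)/a\<close>.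
\<close>
lemma gaussian_tail_le_density_div: assumes "a > 0" shows "gaussian_tail a \<le> std_normal_density a / a"
proof -
  have D: "((\<lambda>z. - std_normal_density z / a) has_real_derivative z / a * std_normal_density z) (at z)" for z
    unfolding std_normal_density_def using assms
    by (auto intro!: derivative_eq_intros simp: field_simps power2_eq_square)
  have lim: "((\<lambda>z. - std_normal_density z / a) \<longlongrightarrow> 0) at_top"
    unfolding std_normal_density_def using assms by real_asymp
  have "ennreal (gaussian_tail a) \<le> (\<integral>\<^sup>+z. ennreal (z / a * std_normal_density z) * indicator {a..} z \<partial>lborel)"
    unfolding ennreal_gaussian_tail
  proof (intro nn_integral_mono)
    fix z :: real
    have "std_normal_density z \<le> z / a * std_normal_density z" if "a \<le> z"
      using mult_right_mono[of 1 "z / a" "std_normal_density z"] that assms by simp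
    then show "ennreal (std_normal_density z) * indicator {a..} z
      \<le> ennreal (z / a * std_normal_density z) * indicator {a..} z"
      by (auto split: split_indicator intro: ennreal_leI)
  qed
  also have "\<dots> = ennreal (0 - (- std_normal_density a / a))"
    using assms by (intro nn_integral_FTC_atLeast D lim) (auto)
  finally show ?thesis using assms by simp
qed

text \<open>
  The left-hand side is the probability that \<open>X \<le> -s\<close> and \<open>Y \<ge> t\<close> for standard normal \<open>X\<close>, \<open>Y\<close>
  with correlation \<open>\<rho>\<close>. Using the Mills inequality for \<open>Y\<close> given \<open>X\<close> and then for the remaining
  integral over \<open>X\<close> gives the factor \<open>\<sigma>\<^sup>2 / (s + \<rho> t)\<close>, which is weakened to \<open>1 / s\<close>.
\<close>
lemma gaussian_quadrant_le:
  fixes s t \<rho> :: real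
  assumes "s > 0" "t > 0" "0 < \<rho>" "\<rho> < 1"
  defines "\<sigma> \<equiv> sqrt (1 - \<rho>\<^sup>2)"
  shows "(\<integral>r. indicator {..-s} r * gaussian_tail ((t - \<rho> * r) / \<sigma>) \<partial>std_normal_distribution)
    \<le> \<sigma> / (2 * pi * s * (\<rho> * s + t)) * exp (- (1/2) * ((s\<^sup>2 + 2 * \<rho> * s * t + t\<^sup>2) / (1 - \<rho>\<^sup>2)))"
    (is "?L \<le> ?R")
proof -
  have r2: "\<rho>\<^sup>2 < 1" using assms by (simp add: power_less_one_iff)
  have \<sigma>: "\<sigma> > 0" "\<sigma>\<^sup>2 = 1 - \<rho>\<^sup>2" using r2 by (auto simp: \<sigma>_def)
  have ts: "0 < t + \<rho> * s" "0 < s + \<rho> * t" using assms by (auto intro!: add_pos_pos mult_pos_pos)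
  let ?\<phi> = std_normal_density
  let ?c = "\<sigma> / (t + \<rho> * s) * ?\<phi> t"
  have c: "?c \<ge> 0" using \<sigma> ts by simp
  \<comment> \<open>The joint density can be conditioned on either variable.\<close>
  have swap: "?\<phi> r * ?\<phi> ((t - \<rho> * r) / \<sigma>) = ?\<phi> t * ?\<phi> ((r - \<rho> * t) / \<sigma>)" for r
  proof -
    have "r\<^sup>2 * \<sigma>\<^sup>2 + (t - \<rho> * r)\<^sup>2 = t\<^sup>2 * \<sigma>\<^sup>2 + (r - \<rho> * t)\<^sup>2"
      unfolding \<sigma>(2) by (simp add: power2_eq_square algebra_simps)
    then have "r\<^sup>2 + ((t - \<rho> * r) / \<sigma>)\<^sup>2 = t\<^sup>2 + ((r - \<rho> * t) / \<sigma>)\<^sup>2"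
      using \<sigma>(1) by (simp add: power_divide field_simps)
    then show ?thesis
      by (simp add: std_normal_density_def mult_exp_exp field_simps)
  qed
  have pt: "?\<phi> r * gaussian_tail ((t - \<rho> * r) / \<sigma>) \<le> ?c * ?\<phi> ((r - \<rho> * t) / \<sigma>)" if "r \<le> - s" for r
  proof -
    have "\<rho> * s \<le> - (\<rho> * r)" using that assms(3) mult_left_mono[of s "-r" \<rho>] by simp
    then have u: "t + \<rho> * s \<le> t - \<rho> * r" by simp
    then have pos: "(t - \<rho> * r) / \<sigma> > 0" using ts \<sigma> by simp
    have "gaussian_tail ((t - \<rho> * r) / \<sigma>) \<le> ?\<phi> ((t - \<rho> * r) / \<sigma>) / ((t - \<rho> * r) / \<sigma>)"
      by (rule gaussian_tail_le_density_div[OF pos])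
    also have "\<dots> = \<sigma> / (t - \<rho> * r) * ?\<phi> ((t - \<rho> * r) / \<sigma>)"
      by simp
    also have "\<dots> \<le> \<sigma> / (t + \<rho> * s) * ?\<phi> ((t - \<rho> * r) / \<sigma>)"
      using u ts \<sigma> by (intro mult_right_mono divide_left_mono) auto
    finally have "?\<phi> r * gaussian_tail ((t - \<rho> * r) / \<sigma>) \<le> ?\<phi> r * (\<sigma> / (t + \<rho> * s) * ?\<phi> ((t - \<rho> * r) / \<sigma>))"
      by (intro mult_left_mono) auto
    also have "\<dots> = ?c * ?\<phi> ((r - \<rho> * t) / \<sigma>)"
      using swap[of r] by (simp add: algebra_simps)
    finally show ?thesis .
  qed
  interpret real_distribution std_normal_distribution by (rule real_dist_normal_dist)
  have "ennreal ?L = (\<integral>\<^sup>+r. ennreal (indicator {..-s} r * gaussian_tail ((t - \<rho> * r) / \<sigma>)) \<partial>std_normal_distribution)"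
    by (intro nn_integral_eq_integral[symmetric] integrable_const_bound[where B=1])
       (auto simp: gaussian_tail_nonneg gaussian_tail_le_1 split: split_indicator)
  also have "\<dots> = (\<integral>\<^sup>+r. ennreal (?\<phi> r) * ennreal (indicator {..-s} r * gaussian_tail ((t - \<rho> * r) / \<sigma>)) \<partial>lborel)"
    by (simp add: nn_integral_density)
  also have "\<dots> \<le> (\<integral>\<^sup>+r. ennreal ?c * (ennreal (?\<phi> ((r - \<rho> * t) / \<sigma>)) * indicator {..-s} r) \<partial>lborel)"
  proof (intro nn_integral_mono)
    fix r :: real
    show "ennreal (?\<phi> r) * ennreal (indicator {..-s} r * gaussian_tail ((t - \<rho> * r) / \<sigma>))
       \<le> ennreal ?c * (ennreal (?\<phi> ((r - \<rho> * t) / \<sigma>)) * indicator {..-s} r)"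
      using pt[of r] c gaussian_tail_nonneg
      by (auto split: split_indicator simp flip: ennreal_mult intro!: ennreal_leI)
  qed
  also have "\<dots> = ennreal ?c * (\<integral>\<^sup>+r. ennreal (?\<phi> ((r - \<rho> * t) / \<sigma>)) * indicator {..-s} r \<partial>lborel)"
    by (intro nn_integral_cmult) auto
  \<comment> \<open>Substituting \<open>r = \<rho> t - \<sigma> z\<close> turns the lower tail into a standard upper tail.\<close>
  also have "(\<integral>\<^sup>+r. ennreal (?\<phi> ((r - \<rho> * t) / \<sigma>)) * indicator {..-s} r \<partial>lborel)
     = ennreal \<sigma> * (\<integral>\<^sup>+z. ennreal (?\<phi> z) * indicator {(s + \<rho> * t) / \<sigma>..} z \<partial>lborel)"
  proof (subst nn_integral_real_affine[where c="-\<sigma>" and t="\<rho> * t"])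
    have "(\<integral>\<^sup>+z. ennreal (?\<phi> ((\<rho> * t + - \<sigma> * z - \<rho> * t) / \<sigma>)) * indicator {..-s} (\<rho> * t + - \<sigma> * z) \<partial>lborel)
      = (\<integral>\<^sup>+z. ennreal (?\<phi> z) * indicator {(s + \<rho> * t) / \<sigma>..} z \<partial>lborel)"
    proof (intro nn_integral_cong)
      fix z
      have "(\<rho> * t + - \<sigma> * z - \<rho> * t) / \<sigma> = - z" using \<sigma> by simp
      moreover have "?\<phi> (- z) = ?\<phi> z" by (simp add: std_normal_density_def)
      moreover have "\<rho> * t + - \<sigma> * z \<le> - s \<longleftrightarrow> (s + \<rho> * t) / \<sigma> \<le> z"
        using \<sigma>(1) by (auto simp: field_simps)
      ultimately show "ennreal (?\<phi> ((\<rho> * t + - \<sigma> * z - \<rho> * t) / \<sigma>)) * indicator {..-s} (\<rho> * t + - \<sigma> * z)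
        = ennreal (?\<phi> z) * indicator {(s + \<rho> * t) / \<sigma>..} z"
        by (simp add: indicator_def)
    qed
    then show "ennreal \<bar>- \<sigma>\<bar> * (\<integral>\<^sup>+z. ennreal (?\<phi> ((\<rho> * t + - \<sigma> * z - \<rho> * t) / \<sigma>)) * indicator {..-s} (\<rho> * t + - \<sigma> * z) \<partial>lborel)
      = ennreal \<sigma> * (\<integral>\<^sup>+z. ennreal (?\<phi> z) * indicator {(s + \<rho> * t) / \<sigma>..} z \<partial>lborel)"
      using \<sigma> by simp
  qed (use \<sigma> in auto)
  also have "(\<integral>\<^sup>+z. ennreal (?\<phi> z) * indicator {(s + \<rho> * t) / \<sigma>..} z \<partial>lborel) = ennreal (gaussian_tail ((s + \<rho> * t) / \<sigma>))"
    by (simp add: ennreal_gaussian_tail)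
  finally have "ennreal ?L \<le> ennreal (?c * (\<sigma> * gaussian_tail ((s + \<rho> * t) / \<sigma>)))"
    unfolding ennreal_mult[OF c mult_nonneg_nonneg[OF less_imp_le[OF \<sigma>(1)] gaussian_tail_nonneg]]
      ennreal_mult[OF less_imp_le[OF \<sigma>(1)] gaussian_tail_nonneg] .
  then have "?L \<le> ?c * (\<sigma> * gaussian_tail ((s + \<rho> * t) / \<sigma>))"
    using \<sigma> ts gaussian_tail_nonneg by (subst (asm) ennreal_le_iff) auto
  also have "\<dots> \<le> ?c * (\<sigma> * (?\<phi> ((s + \<rho> * t) / \<sigma>) / ((s + \<rho> * t) / \<sigma>)))"
    using \<sigma> c ts by (intro mult_left_mono gaussian_tail_le_density_div) auto
  also have "\<dots> = (\<sigma> / (t + \<rho> * s)) * (\<sigma>\<^sup>2 / (s + \<rho> * t)) * (?\<phi> t * ?\<phi> ((s + \<rho> * t) / \<sigma>))"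
    by (simp add: power2_eq_square)
  also have "\<dots> \<le> (\<sigma> / (t + \<rho> * s)) * (1 / s) * (?\<phi> t * ?\<phi> ((s + \<rho> * t) / \<sigma>))"
  proof -
    have "\<sigma>\<^sup>2 \<le> 1" using \<sigma> by simp
    then have "\<sigma>\<^sup>2 / (s + \<rho> * t) \<le> 1 / s"
      using assms by (intro frac_le) auto
    then show ?thesis using \<sigma> ts
      by (intro mult_right_mono mult_left_mono) auto
  qed
  also have "?\<phi> t * ?\<phi> ((s + \<rho> * t) / \<sigma>) 
     = 1 / (2 * pi) * exp (- (1/2) * ((s\<^sup>2 + 2 * \<rho> * s * t + t\<^sup>2) / (1 - \<rho>\<^sup>2)))"
  proof -
    have "t\<^sup>2 * \<sigma>\<^sup>2 + (s + \<rho> * t)\<^sup>2 = s\<^sup>2 + 2 * \<rho> * s * t + t\<^sup>2"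
      unfolding \<sigma>(2) by (simp add: power2_eq_square algebra_simps)
    then have exponent: "t\<^sup>2 + ((s + \<rho> * t) / \<sigma>)\<^sup>2 = (s\<^sup>2 + 2 * \<rho> * s * t + t\<^sup>2) / (1 - \<rho>\<^sup>2)"
      unfolding \<sigma>(2)[symmetric] using \<sigma>(1) by (simp add: power_divide field_simps)
    have e: "- t\<^sup>2 / 2 + - ((s + \<rho> * t) / \<sigma>)\<^sup>2 / 2 = - (1/2) * ((s\<^sup>2 + 2 * \<rho> * s * t + t\<^sup>2) / (1 - \<rho>\<^sup>2))"
      unfolding exponent[symmetric] by (simp only: distrib_left)
    have "?\<phi> t * ?\<phi> ((s + \<rho> * t) / \<sigma>) 
      = (1 / sqrt (2 * pi)) * (1 / sqrt (2 * pi)) * exp (- t\<^sup>2 / 2 + - ((s + \<rho> * t) / \<sigma>)\<^sup>2 / 2)"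
      unfolding std_normal_density_def exp_add by simp
    then show ?thesis
      unfolding e by simp
  qed
  finally show ?thesis by (simp add: ac_simps)
qed

section \<open>Conditioning on the original point\<close>

lemma lower_ball_iff_scaled_sum: "n > 0 \<Longrightarrow> x \<in> lower_ball n s \<longleftrightarrow> x \<in> cube n \<and> scaled_sum n x \<le> - s"
  by (simp add: lower_ball_def scaled_sum_def pos_divide_le_eq)

lemma upper_ball_iff_scaled_sum: "n > 0 \<Longrightarrow> x \<in> upper_ball n t \<longleftrightarrow> x \<in> cube n \<and> t \<le> scaled_sum n x"
  by (simp add: upper_ball_def scaled_sum_def pos_le_divide_eq)

lemma finite_cube: "finite (cube n)" and cube_nonempty: "cube n \<noteq> {}"
  unfolding cube_def by (auto intro!: finite_PiE simp: PiE_eq_empty_iff)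

lemma cube_eq_PiE_dflt: "cube n = PiE_dflt {..<n} undefined (\<lambda>_. {-1, 1})"
  by (auto simp: cube_def PiE_dflt_def PiE_def Pi_def extensional_def)

lemma set_correlated_copy_subset: "x \<in> cube n \<Longrightarrow> set_pmf (correlated_copy n \<rho> x) \<subseteq> cube n"
proof
  fix y assume x: "x \<in> cube n" and "y \<in> set_pmf (correlated_copy n \<rho> x)"
  then have y: "y \<in> PiE_dflt {..<n} undefined
      (\<lambda>i. (\<lambda>flip. if flip then - x i else x i) ` set_pmf (bernoulli_pmf (1/2 - \<rho>/2)))"
    by (simp add: correlated_copy_def set_Pi_pmf o_def)
  have "y i \<in> {-1, 1}" if "i < n" for i
  proof -
    have "y i = - x i \<or> y i = x i"
      using y that by (auto simp: PiE_dflt_def)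
    then show ?thesis using cube_values[OF x that] by auto
  qed
  moreover have "y i = undefined" if "\<not> i < n" for i
    using y that by (auto simp: PiE_dflt_def)
  ultimately show "y \<in> cube n" by (auto simp: cube_eq_PiE_dflt PiE_dflt_def)
qed

text \<open>
  Flipping a sign with probability one half makes it uniform whatever its value. Results on
  copies thereby apply to the uniform original point.
\<close>
lemma correlated_copy_0_uniform:
  assumes "x \<in> cube n"
  shows "correlated_copy n 0 x = pmf_of_set (cube n)"
proof -
  have flip: "map_pmf (\<lambda>flip. if flip then - v else v) (bernoulli_pmf (1/2)) = pmf_of_set {-1, 1}"
    if "v = -1 \<or> v = 1" for v :: real
  proof -
    have "map_pmf (\<lambda>flip. if flip then - v else v) (pmf_of_set UNIV)
      = pmf_of_set ((\<lambda>flip. if flip then - v else v) ` UNIV)"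
      using that by (intro map_pmf_of_set_inj) (auto simp: inj_on_def)
    also have "(\<lambda>flip. if flip then - v else v) ` UNIV = {-1, 1}"
      using that by (auto simp: UNIV_bool)
    finally show ?thesis by (simp add: bernoulli_pmf_half_conv_pmf_of_set)
  qed
  have "correlated_copy n 0 x = Pi_pmf {..<n} undefined (\<lambda>_. pmf_of_set {-1, 1})"
    unfolding correlated_copy_def
    using cube_values[OF assms] by (intro Pi_pmf_cong refl) (simp add: flip)
  then show ?thesis
    by (simp add: Pi_pmf_of_set cube_eq_PiE_dflt)
qed

lemma prob_upper_ball_conv_copy_law:
  assumes "n > 0" "x \<in> cube n"
  shows "measure_pmf.prob (correlated_copy n \<rho> x) (upper_ball n t) = measure (copy_law n \<rho> x) {t..}"
proof -
  have "measure (copy_law n \<rho> x) {t..} = measure_pmf.prob (correlated_copy n \<rho> x) (scaled_sum n -` {t..})"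
    by (simp add: copy_law_def measure_distr)
  also have "\<dots> = measure_pmf.prob (correlated_copy n \<rho> x) (upper_ball n t)"
    using assms set_correlated_copy_subset[OF assms(2)]
    by (intro measure_pmf.finite_measure_eq_AE AE_pmfI) (auto simp: upper_ball_iff_scaled_sum)
  finally show ?thesis by simp
qed

lemma prob_opposite_balls_conv_copy_law:
  assumes "n > 0"
  shows "measure_pmf.prob (correlated_pair n \<rho>) {(x, y). x \<in> lower_ball n s \<and> y \<in> upper_ball n t}
   = (\<integral>x. indicator {..-s} (scaled_sum n x) * measure (copy_law n \<rho> x) {t..} \<partial>pmf_of_set (cube n))"
    (is "measure_pmf.prob _ ?E = _")
proof -
  have "ennreal (measure_pmf.prob (correlated_pair n \<rho>) ?E)
    = (\<integral>\<^sup>+x. emeasure (map_pmf (\<lambda>y. (x, y)) (correlated_copy n \<rho> x)) ?E \<partial>pmf_of_set (cube n))"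
    unfolding correlated_pair_def by (simp add: measure_pmf.emeasure_eq_measure[symmetric] del: emeasure_map_pmf)
  also have "\<dots> = (\<integral>\<^sup>+x. ennreal (indicator {..-s} (scaled_sum n x) * measure (copy_law n \<rho> x) {t..}) \<partial>pmf_of_set (cube n))"
  proof (intro nn_integral_cong_AE AE_pmfI)
    fix x assume "x \<in> set_pmf (pmf_of_set (cube n))"
    then have x: "x \<in> cube n" by (simp add: finite_cube cube_nonempty)
    have "emeasure (map_pmf (\<lambda>y. (x, y)) (correlated_copy n \<rho> x)) ?E
      = ennreal (measure_pmf.prob (correlated_copy n \<rho> x) {y. x \<in> lower_ball n s \<and> y \<in> upper_ball n t})"
      by (simp add: measure_pmf.emeasure_eq_measure vimage_def)
    also have "\<dots> = ennreal (indicator {..-s} (scaled_sum n x) * measure (copy_law n \<rho> x) {t..})"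
      using x assms by (simp add: lower_ball_iff_scaled_sum indicator_def prob_upper_ball_conv_copy_law[symmetric])
    finally show "emeasure (map_pmf (\<lambda>y. (x, y)) (correlated_copy n \<rho> x)) ?E
      = ennreal (indicator {..-s} (scaled_sum n x) * measure (copy_law n \<rho> x) {t..})" .
  qed
  also have "\<dots> = ennreal (\<integral>x. indicator {..-s} (scaled_sum n x) * measure (copy_law n \<rho> x) {t..} \<partial>pmf_of_set (cube n))"
    by (intro nn_integral_eq_integral integrable_measure_pmf_finite) (auto simp: finite_cube cube_nonempty)
  finally show ?thesis
    by (subst (asm) ennreal_inj) (auto intro!: integral_nonneg_AE)
qed

text \<open>
  The conditional probability as a function of the value \<open>r\<close> of the normalised sum of \<open>x\<close>. It is
  defined on all reals, with \<open>0\<close> at values that are not attained, because Skorohod's theorem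
  replaces the random point \<open>x\<close> by a random real.
\<close>
definition tail_given_sum :: "nat \<Rightarrow> real \<Rightarrow> real \<Rightarrow> real \<Rightarrow> real" where
  "tail_given_sum n \<rho> t r = (if r \<in> scaled_sum n ` cube n
     then measure (copy_law n \<rho> (inv_into (cube n) (scaled_sum n) r)) {t..} else 0)"

lemma tail_given_sum_eq:
  assumes "0 < \<rho>" "\<rho> \<le> 1" "x \<in> cube n"
  shows "tail_given_sum n \<rho> t (scaled_sum n x) = measure (copy_law n \<rho> x) {t..}"
proof -
  have "copy_law n \<rho> (inv_into (cube n) (scaled_sum n) (scaled_sum n x)) = copy_law n \<rho> x"
    using assms by (intro copy_law_cong_sum) (auto intro: inv_into_into simp: f_inv_into_f[where f="scaled_sum n"])
  then show ?thesis using assms by (auto simp: tail_given_sum_def)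
qed

text \<open>It differs from \<open>0\<close> at finitely many points only.\<close>
lemma tail_given_sum_measurable [measurable]: "tail_given_sum n \<rho> t \<in> borel_measurable borel"
  by (rule measurable_discrete_difference[of "\<lambda>_. 0" _ _ "scaled_sum n ` cube n"])
     (auto simp: tail_given_sum_def finite_cube countable_finite)

lemma tail_given_sum_bound: "norm (tail_given_sum n \<rho> t r) \<le> 1"
  unfolding tail_given_sum_def copy_law_def
  by (auto intro!: prob_space.prob_le_1 prob_space.prob_space_distr measure_pmf.prob_space_axioms)

section \<open>The limit\<close>

lemma tail_given_sum_tendsto:
  assumes "0 < \<rho>" "\<rho> < 1" "r \<longlonglongrightarrow> a" and r: "\<And>n. r n \<in> scaled_sum n ` cube n"
  shows "(\<lambda>n. tail_given_sum n \<rho> t (r n)) \<longlonglongrightarrow> gaussian_tail ((t - \<rho> * a) / sqrt (1 - \<rho>\<^sup>2))"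
proof -
  interpret std: real_distribution std_normal_distribution by (rule real_dist_normal_dist)
  let ?\<sigma> = "sqrt (1 - \<rho>\<^sup>2)"
  have \<sigma>: "?\<sigma> > 0" using assms by (simp add: power_less_one_iff)
  define x where "x n = inv_into (cube n) (scaled_sum n) (r n)" for n
  have x: "x n \<in> cube n" "scaled_sum n (x n) = r n" for n
    using r[of n] by (auto simp: x_def inv_into_into f_inv_into_f)
  let ?N = "distr std_normal_distribution borel (\<lambda>z. \<rho> * a + ?\<sigma> * z)"
  have N: "real_distribution ?N" by simp
  have w: "weak_conv_m (\<lambda>n. copy_law n \<rho> (x n)) ?N"
    using assms x by (intro copy_law_central_limit tendsto_mult tendsto_const) auto
  have null: "emeasure ?N (frontier {t..}) = 0"
  proof -
    have "emeasure ?N {t} = emeasure std_normal_distribution {(t - \<rho> * a) / ?\<sigma>}"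
      using \<sigma> by (simp add: emeasure_distr) (rule arg_cong[where f="emeasure _"], auto simp: field_simps)
    also have "\<dots> = 0"
      by (subst emeasure_density) (auto simp: nn_integral_indicator_singleton')
    moreover have "frontier {t..} = {t}" by (auto simp: frontier_def)
    ultimately show ?thesis by simp
  qed
  have "(\<lambda>n. measure (copy_law n \<rho> (x n)) {t..}) \<longlonglongrightarrow> measure ?N {t..}"
    by (rule weak_conv_imp_continuity_set_conv[OF real_distribution_copy_law N w _ null]) simp
  moreover have "measure ?N {t..} = gaussian_tail ((t - \<rho> * a) / ?\<sigma>)"
    using \<sigma> by (simp add: measure_distr gaussian_tail_def) (rule arg_cong[where f="measure _"], auto simp: field_simps)
  moreover have "measure (copy_law n \<rho> (x n)) {t..} = tail_given_sum n \<rho> t (r n)" for n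
    using tail_given_sum_eq[of \<rho> "x n" n t] x assms by simp
  ultimately show ?thesis by simp
qed

text \<open>
  Skorohod's theorem represents the normalised sums of \<open>x\<close> by random variables that converge
  pointwise to a standard normal variable. Along almost every path the sums are attained values
  and the limit is not the discontinuity \<open>-s\<close> of the indicator, so that the integrand converges.
\<close>
lemma prob_opposite_balls_tendsto:
  fixes s t \<rho> :: real
  assumes "0 < \<rho>" "\<rho> < 1"
  shows "(\<lambda>n. measure_pmf.prob (correlated_pair n \<rho>) {(x, y). x \<in> lower_ball n s \<and> y \<in> upper_ball n t})
    \<longlonglongrightarrow> (\<integral>r. indicator {..-s} r * gaussian_tail ((t - \<rho> * r) / sqrt (1 - \<rho>\<^sup>2)) \<partial>std_normal_distribution)"
proof -
  interpret std: real_distribution std_normal_distribution by (rule real_dist_normal_dist)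
  \<comment> \<open>The law of the sum of \<open>x\<close> is that of a copy with correlation \<open>0\<close> of any point.\<close>
  define x0 where "x0 n = (SOME x. x \<in> cube n)" for n
  have x0: "x0 n \<in> cube n" for n
    unfolding x0_def using cube_nonempty by (simp add: some_in_eq)
  define \<mu> where "\<mu> n = copy_law n 0 (x0 n)" for n
  have \<mu>: "\<mu> n = distr (pmf_of_set (cube n)) borel (scaled_sum n)" for n
    unfolding \<mu>_def copy_law_def correlated_copy_0_uniform[OF x0] ..
  have "weak_conv_m \<mu> (distr std_normal_distribution borel (\<lambda>z. 0 + sqrt (1 - 0\<^sup>2) * z))"
    unfolding \<mu>_def by (intro copy_law_central_limit x0) auto
  moreover have "distr std_normal_distribution borel (\<lambda>z. 0 + sqrt (1 - 0\<^sup>2) * z) = std_normal_distribution"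
    by (simp add: distr_id2)
  ultimately have w: "weak_conv_m \<mu> std_normal_distribution" by simp
  have r\<mu>: "real_distribution (\<mu> n)" for n
    unfolding \<mu>_def by (rule real_distribution_copy_law)
  obtain \<Omega> :: "real measure" and Y_seq Y where \<Omega>: "prob_space \<Omega>"
    and Yn[measurable]: "\<And>n. Y_seq n \<in> borel_measurable \<Omega>" and dYn: "\<And>n. distr \<Omega> borel (Y_seq n) = \<mu> n"
    and Y: "Y \<in> measurable \<Omega> lborel" and dY: "distr \<Omega> borel Y = std_normal_distribution"
    and lim: "\<And>\<omega>. \<omega> \<in> space \<Omega> \<Longrightarrow> (\<lambda>n. Y_seq n \<omega>) \<longlonglongrightarrow> Y \<omega>"
    using Skorohod[OF r\<mu> real_dist_normal_dist w] by blast
  have [measurable]: "Y \<in> borel_measurable \<Omega>" using Y by simp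
  interpret \<Omega>: prob_space \<Omega> by fact
  let ?H = "\<lambda>r. gaussian_tail ((t - \<rho> * r) / sqrt (1 - \<rho>\<^sup>2))"
  let ?I = "indicator {..-s} :: real \<Rightarrow> real"
  have attained: "AE \<omega> in \<Omega>. \<forall>n. Y_seq n \<omega> \<in> scaled_sum n ` cube n"
  proof (subst AE_all_countable, intro allI)
    fix n
    have [measurable]: "scaled_sum n ` cube n \<in> sets borel"
      by (intro borel_closed finite_imp_closed finite_imageI finite_cube)
    have "AE r in \<mu> n. r \<in> scaled_sum n ` cube n"
      unfolding \<mu> by (subst AE_distr_iff) (auto intro!: AE_pmfI simp: finite_cube cube_nonempty)
    then show "AE \<omega> in \<Omega>. Y_seq n \<omega> \<in> scaled_sum n ` cube n"
      unfolding dYn[symmetric] by (subst (asm) AE_distr_iff) auto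
  qed
  have off: "AE \<omega> in \<Omega>. Y \<omega> \<noteq> - s"
  proof -
    have "AE r in std_normal_distribution. r \<noteq> - s"
      using AE_lborel_singleton[of "-s"] by (subst AE_density) auto
    then show ?thesis
      unfolding dY[symmetric] by (subst (asm) AE_distr_iff) auto
  qed
  have "(\<lambda>n. \<integral>\<omega>. ?I (Y_seq n \<omega>) * tail_given_sum n \<rho> t (Y_seq n \<omega>) \<partial>\<Omega>) \<longlonglongrightarrow> (\<integral>\<omega>. ?I (Y \<omega>) * ?H (Y \<omega>) \<partial>\<Omega>)"
  proof (rule integral_dominated_convergence[where w="\<lambda>_. 1"])
    show "AE \<omega> in \<Omega>. (\<lambda>n. ?I (Y_seq n \<omega>) * tail_given_sum n \<rho> t (Y_seq n \<omega>)) \<longlonglongrightarrow> ?I (Y \<omega>) * ?H (Y \<omega>)"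
      using attained off AE_space
    proof eventually_elim
      case (elim \<omega>)
      have "isCont ?I (Y \<omega>)" using elim by (simp add: isCont_indicator frontier_def)
      then have "(\<lambda>n. ?I (Y_seq n \<omega>)) \<longlonglongrightarrow> ?I (Y \<omega>)"
        using lim[OF elim(3)] by (rule isCont_tendsto_compose)
      then show ?case
        using elim lim assms by (intro tendsto_mult tail_given_sum_tendsto) auto
    qed
    show "AE \<omega> in \<Omega>. norm (?I (Y_seq n \<omega>) * tail_given_sum n \<rho> t (Y_seq n \<omega>)) \<le> 1" for n
      using tail_given_sum_bound by (auto split: split_indicator)
  qed auto
  also have "(\<integral>\<omega>. ?I (Y \<omega>) * ?H (Y \<omega>) \<partial>\<Omega>) = (\<integral>r. ?I r * ?H r \<partial>std_normal_distribution)"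
    unfolding dY[symmetric] by (subst integral_distr) auto
  finally have "(\<lambda>n. \<integral>\<omega>. ?I (Y_seq n \<omega>) * tail_given_sum n \<rho> t (Y_seq n \<omega>) \<partial>\<Omega>)
    \<longlonglongrightarrow> (\<integral>r. ?I r * ?H r \<partial>std_normal_distribution)" .
  \<comment> \<open>At \<open>n = 0\<close> the normalisation degenerates: the sum \<open>0\<close> lies in both balls for every \<open>s\<close>, \<open>t\<close>.\<close>
  moreover have "(\<integral>\<omega>. ?I (Y_seq n \<omega>) * tail_given_sum n \<rho> t (Y_seq n \<omega>) \<partial>\<Omega>)
    = measure_pmf.prob (correlated_pair n \<rho>) {(x, y). x \<in> lower_ball n s \<and> y \<in> upper_ball n t}"
    if "n > 0" for n
  proof -
    have "(\<integral>\<omega>. ?I (Y_seq n \<omega>) * tail_given_sum n \<rho> t (Y_seq n \<omega>) \<partial>\<Omega>)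
      = (\<integral>r. ?I r * tail_given_sum n \<rho> t r \<partial>\<mu> n)"
      unfolding dYn[symmetric] by (subst integral_distr) auto
    also have "\<dots> = (\<integral>x. ?I (scaled_sum n x) * tail_given_sum n \<rho> t (scaled_sum n x) \<partial>pmf_of_set (cube n))"
      unfolding \<mu> by (subst integral_distr) auto
    also have "\<dots> = (\<integral>x. ?I (scaled_sum n x) * measure (copy_law n \<rho> x) {t..} \<partial>pmf_of_set (cube n))"
      using assms by (intro integral_cong_AE AE_pmfI) (auto simp: finite_cube cube_nonempty tail_given_sum_eq)
    finally show ?thesis using prob_opposite_balls_conv_copy_law[OF that] by simp
  qed
  ultimately show ?thesis
    by (rule Lim_transform_eventually[OF _ eventually_mono[OF eventually_gt_at_top[of 0]]]) auto
qed

theorem proposition3p9: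
  fixes s t \<rho> :: real
  assumes "s > 0" and "t > 0" and "0 < \<rho>" and "\<rho> < 1"
  defines "P \<equiv> (\<lambda>n. measure_pmf.prob (correlated_pair n \<rho>)
                    {(x, y). x \<in> lower_ball n s \<and> y \<in> upper_ball n t})"
  shows "convergent P \<and>
         lim P \<le> sqrt (1 - \<rho>\<^sup>2) / (2 * pi * s * (\<rho> * s + t))
                 * exp (- (1/2) * ((s\<^sup>2 + 2 * \<rho> * s * t + t\<^sup>2) / (1 - \<rho>\<^sup>2)))"
proof -
  have "P \<longlonglongrightarrow> (\<integral>r. indicator {..-s} r * gaussian_tail ((t - \<rho> * r) / sqrt (1 - \<rho>\<^sup>2)) \<partial>std_normal_distribution)"
    unfolding P_def using assms(3,4) by (rule prob_opposite_balls_tendsto)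
  then show ?thesis
    using gaussian_quadrant_le[OF assms(1-4)] by (auto simp: convergent_def limI)
qed

end
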